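(* Let $d\in\mathbb N$ and let $\vec\mu=(\mu_1,\dots,\mu_d)$ be an Angelesco system. Then: (A) $\vec\mu$ is perfect; (B) $a_{\vec n,j}>0$ for all $j\in\{1,\dots,d\}$ and all $\vec n\in\mathbb Z_+^d$ such that $n_j>0$; (C) $\displaystyle\sup_{\vec n\in\mathbb N^d,\ j\in\{1,\dots,d\}}a_{\vec n,j}<\infty$ and $\displaystyle\sup_{\vec n\in\mathbb N^d,\ j\in\{1,\dots,d\}}|b_{\vec n,j}|<\infty$. Here $a_{\vec n,j},b_{\vec n,j}$ are the nearest-neighbor recurrence coefficients of $\vec\mu$.
   Context: Notation: $\mathbb N=\{1,2,\dots\}$, $\mathbb Z_+=\{0,1,2,\dots\}$; $\vec e_1,\dots,\vec e_d$ is the standard basis of $\mathbb R^d$; $|\vec n|=n_1+\cdots+n_d$ for $\vec n=(n_1,\dots,n_d)\in\mathbb Z_+^d$. Measures: $\mu_1,\dots,\mu_d$ are positive finite Borel measures on $\mathbb R$; each $\operatorname{supp}\mu_j$ is not a finite set, and all moments are finite. Angelesco system: $\Delta_i$ denotes the convex hull of $\operatorname{supp}\mu_i$. The system $\vec\mu$ is an Angelesco system if $\Delta_1,\dots,\Delta_d$ are pairwise disjoint closed bounded segments; without loss of generality they are numbered so that $\Delta_1<\Delta_2<\dots<\Delta_d$ (where $E_1<E_2$ means $\sup E_1<\inf E_2$). Type II multiple orthogonal polynomial: a nonzero polynomial $P_{\vec n}$ with $\deg P_{\vec n}\le|\vec n|$ and $\int_{\mathbb R}P_{\vec n}(x)x^l\,d\mu_j(x)=0$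 for all $j\in\{1,\dots,d\}$ and $l\in\{0,\dots,n_j-1\}$. The multi-index $\vec n$ is normal if $P_{\vec n}$ is unique up to a multiplicative constant; in this case $P_{\vec n}$ is normalized to be monic, $P_{\vec n}(x)=x^{|\vec n|}+\cdots$. The vector $\vec\mu$ is perfect if all $\vec n\in\mathbb Z_+^d$ are normal. Recurrence coefficients: for perfect $\vec\mu$ there are uniquely determined real numbers $a_{\vec n,j},b_{\vec n,j}$ such that $$xP_{\vec n}(x)=P_{\vec n+\vec e_j}(x)+b_{\vec n,j}P_{\vec n}(x)+\sum_{l=1}^d a_{\vec n,l}P_{\vec n-\vec e_l}(x),\qquad j\in\{1,\dots,d\},\ \vec n\in\mathbb Z_+^d,$$ where $P_{\vec n-\vec e_l}=0$ and $a_{\vec n,l}=0$ if a component of $\vec n-\vec e_l$ is negative. *)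

theory Defs
  imports "HOL-Analysis.Analysis" "HOL-Computational_Algebra.Polynomial"
begin

definition measure_support :: "real measure \<Rightarrow> real set" where
  "measure_support M = {x. \<forall>U. open U \<and> x \<in> U \<longrightarrow> emeasure M U > 0}"

definition admissible_measure :: "real measure \<Rightarrow> bool" where
  "admissible_measure M \<longleftrightarrow>
     sets M = sets borel \<and> finite_measure M \<and> infinite (measure_support M) \<and>
     (\<forall>k::nat. integrable M (\<lambda>x. x ^ k))"

definition supp_hull :: "real measure \<Rightarrow> real set" where
  "supp_hull M = convex hull (measure_support M)"

text \<open>
  The dimension \<open>d\<close> is the cardinality of the finite index type \<open>'d\<close>, and multi-indices are
  functions \<open>'d \<Rightarrow> nat\<close>. The index type carries no order: only the pairwise disjointness of
  the segments is required, so the results hold for every numbering of the measures.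
\<close>

definition angelesco :: "('d::finite \<Rightarrow> real measure) \<Rightarrow> bool" where
  "angelesco \<mu> \<longleftrightarrow>
     (\<forall>j. admissible_measure (\<mu> j)) \<and>
     (\<forall>j. \<exists>a b. supp_hull (\<mu> j) = {a..b}) \<and>
     (\<forall>i j. i \<noteq> j \<longrightarrow> supp_hull (\<mu> i) \<inter> supp_hull (\<mu> j) = {})"

definition msize :: "('d::finite \<Rightarrow> nat) \<Rightarrow> nat" where
  "msize n = (\<Sum>j\<in>UNIV. n j)"

definition type_II_poly :: "('d::finite \<Rightarrow> real measure) \<Rightarrow> ('d \<Rightarrow> nat) \<Rightarrow> real poly \<Rightarrow> bool" where
  "type_II_poly \<mu> n P \<longleftrightarrow>
     P \<noteq> 0 \<and> degree P \<le> msize n \<and>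
     (\<forall>j. \<forall>l<n j. (LINT x|\<mu> j. poly P x * x ^ l) = 0)"

definition normal_index :: "('d::finite \<Rightarrow> real measure) \<Rightarrow> ('d \<Rightarrow> nat) \<Rightarrow> bool" where
  "normal_index \<mu> n \<longleftrightarrow>
     (\<exists>P. type_II_poly \<mu> n P \<and> (\<forall>Q. type_II_poly \<mu> n Q \<longrightarrow> (\<exists>c. Q = smult c P)))"

definition perfect_system :: "('d::finite \<Rightarrow> real measure) \<Rightarrow> bool" where
  "perfect_system \<mu> \<longleftrightarrow> (\<forall>n. normal_index \<mu> n)"

text \<open>The next definite description is only meaningful at normal indices.\<close>

definition mop :: "('d::finite \<Rightarrow> real measure) \<Rightarrow> ('d \<Rightarrow> nat) \<Rightarrow> real poly" where
  "mop \<mu> n = (THE P. type_II_poly \<mu> n P \<and> degree P = msize n \<and> lead_coeff P = 1)"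

definition mop_prev :: "('d::finite \<Rightarrow> real measure) \<Rightarrow> ('d \<Rightarrow> nat) \<Rightarrow> 'd \<Rightarrow> real poly" where
  "mop_prev \<mu> n l = (if n l = 0 then 0 else mop \<mu> (n(l := n l - 1)))"

definition nn_recurrence ::
  "('d::finite \<Rightarrow> real measure) \<Rightarrow> (('d \<Rightarrow> nat) \<Rightarrow> 'd \<Rightarrow> real) \<Rightarrow> (('d \<Rightarrow> nat) \<Rightarrow> 'd \<Rightarrow> real) \<Rightarrow> bool" where
  "nn_recurrence \<mu> a b \<longleftrightarrow>
     (\<forall>n j. [:0, 1:] * mop \<mu> n =
        mop \<mu> (n(j := n j + 1)) + smult (b n j) (mop \<mu> n)
        + (\<Sum>l\<in>UNIV. smult (a n l) (mop_prev \<mu> n l))) \<and>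
     (\<forall>n l. n l = 0 \<longrightarrow> a n l = 0)"

text \<open>
  For a perfect system exactly one pair of coefficient families satisfies the recurrence
  together with the zero convention above; this pair is meant here.
\<close>

definition nn_coeffs ::
  "('d::finite \<Rightarrow> real measure) \<Rightarrow> (('d \<Rightarrow> nat) \<Rightarrow> 'd \<Rightarrow> real) \<times> (('d \<Rightarrow> nat) \<Rightarrow> 'd \<Rightarrow> real)" where
  "nn_coeffs \<mu> = (THE (a, b). nn_recurrence \<mu> a b)"

definition nn_a :: "('d::finite \<Rightarrow> real measure) \<Rightarrow> ('d \<Rightarrow> nat) \<Rightarrow> 'd \<Rightarrow> real" where
  "nn_a \<mu> = fst (nn_coeffs \<mu>)"

definition nn_b :: "('d::finite \<Rightarrow> real measure) \<Rightarrow> ('d \<Rightarrow> nat) \<Rightarrow> 'd \<Rightarrow> real" where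
  "nn_b \<mu> = snd (nn_coeffs \<mu>)"

end

theory Submission
  imports Defs
begin

text \<open>
  An orthogonal polynomial \<open>P\<close> of index \<open>n\<close> changes sign at least \<open>n j\<close> times on each hull, so it
  has exactly \<open>n j\<close> simple zeros there and no others; in particular its degree is maximal, which
  gives uniqueness. Let \<open>h n j\<close> be the integral of \<open>P x ^ n j\<close> against \<open>\<mu> j\<close>. Its sign is
  determined by the components \<open>n i\<close> with \<open>i \<noteq> j\<close>, because the zeros in the other hulls contribute
  a factor of constant sign. Existence and the recurrence are obtained together, by choosing
  \<open>a n l = h n l / h (n - e l) l\<close> and then \<open>b n j\<close> so that the right-hand side of the recurrence,
  solved for the next polynomial, has the required orthogonality; hence \<open>a > 0\<close>.

  If all hulls lie in \<open>(-B, B)\<close>, then evaluating the recurrence at \<open>\<plusminus>B\<close>, where the signs of all terms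
  are known, yields \<open>-B < b < B\<close> and \<open>a n j P(n - e j) \<le> 2B P(n) \<le> (2B)\<^sup>2 P(n - e j)\<close> at \<open>B\<close>. No
  interlacing of zeros is needed.
\<close>

subsection \<open>Integrals of polynomials\<close>

definition poly_integral :: "real measure \<Rightarrow> real poly \<Rightarrow> real" where
  "poly_integral M p = (LINT x|M. poly p x)"

lemma integrable_poly:
  assumes "admissible_measure M"
  shows "integrable M (poly p)"
  using assms unfolding admissible_measure_def poly_altdef
  by (intro Bochner_Integration.integrable_sum integrable_mult_right) auto

lemma poly_integral_0 [simp]: "poly_integral M 0 = 0"
  by (simp add: poly_integral_def)

lemma poly_integral_smult [simp]: "poly_integral M (smult c p) = c * poly_integral M p"
  by (simp add: poly_integral_def)

lemma
  assumes "admissible_measure M"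
  shows poly_integral_add: "poly_integral M (p + q) = poly_integral M p + poly_integral M q"
    and poly_integral_diff: "poly_integral M (p - q) = poly_integral M p - poly_integral M q"
    and poly_integral_sum: "poly_integral M (\<Sum>i\<in>S. f i) = (\<Sum>i\<in>S. poly_integral M (f i))"
  using integrable_poly[OF assms] by (simp_all add: poly_integral_def poly_sum)

text \<open>Off the support every point has an open null neighbourhood; by the Lindelof property
  countably many of these cover the complement.\<close>

lemma AE_in_measure_support:
  assumes "admissible_measure M"
  shows "AE x in M. x \<in> measure_support M"
proof -
  have sets: "sets M = sets borel" using assms by (simp add: admissible_measure_def)
  define F where "F = {U. open U \<and> emeasure M U = 0}"
  have compl: "- measure_support M = \<Union>F"
    by (auto simp: measure_support_def F_def)
  obtain F' where F': "F' \<subseteq> F" "countable F'" "\<Union>F' = \<Union>F"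
    using Lindelof[of F] by (auto simp: F_def)
  have "(\<Union>U\<in>F'. U) \<in> null_sets M"
    using F' sets by (intro null_sets_UN') (auto simp: F_def null_sets_def)
  with F' compl have "- measure_support M \<in> null_sets M" by simp
  then show ?thesis by (rule AE_I') auto
qed

text \<open>A zero integral would make \<open>p\<close> vanish almost everywhere. The open set where
  \<open>p\<close> is nonzero would then be null, so the infinite support would lie among the
  finitely many roots of \<open>p\<close>.\<close>

lemma poly_integral_pos:
  assumes M: "admissible_measure M" and "p \<noteq> 0"
    and nonneg: "\<And>x. x \<in> supp_hull M \<Longrightarrow> poly p x \<ge> 0"
  shows "poly_integral M p > 0"
proof -
  have sets: "sets M = sets borel" using M by (simp add: admissible_measure_def)
  have ae: "AE x in M. 0 \<le> poly p x"
    using AE_in_measure_support[OF M]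
    by eventually_elim (auto intro!: nonneg simp: supp_hull_def hull_inc)
  have "poly_integral M p \<noteq> 0"
  proof
    assume "poly_integral M p = 0"
    then have "AE x in M. poly p x = 0"
      using integral_nonneg_eq_0_iff_AE[OF integrable_poly[OF M] ae] by (simp add: poly_integral_def)
    moreover have "{x. poly p x \<noteq> 0} \<in> sets M"
      unfolding sets by (intro borel_open open_Collect_neq continuous_intros)
    ultimately have null: "emeasure M {x. poly p x \<noteq> 0} = 0"
      using AE_iff_measurable[of "{x. poly p x \<noteq> 0}" M "\<lambda>x. poly p x = 0"] sets_eq_imp_space_eq[OF sets]
      by simp
    have "open {x. poly p x \<noteq> 0}" by (intro open_Collect_neq continuous_intros)
    with null have "measure_support M \<subseteq> {x. poly p x = 0}"
      by (auto simp: measure_support_def)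
    then have "finite (measure_support M)"
      using poly_roots_finite[OF \<open>p \<noteq> 0\<close>] finite_subset by blast
    then show False using M by (simp add: admissible_measure_def)
  qed
  moreover have "poly_integral M p \<ge> 0"
    unfolding poly_integral_def using ae by (rule integral_nonneg_AE)
  ultimately show ?thesis by simp
qed

subsection \<open>Sign changes of polynomials\<close>

lemma sgn_prod:
  fixes f :: "'a \<Rightarrow> 'b::linordered_field"
  shows "sgn (prod f A) = (\<Prod>x\<in>A. sgn (f x))"
  by (induction A rule: infinite_finite_induct) (auto simp: sgn_mult)

definition root_poly :: "real set \<Rightarrow> real poly" where
  "root_poly Z = (\<Prod>r\<in>Z. [:- r, 1:])"

lemma degree_root_poly [simp]: "degree (root_poly Z) = card Z"
  by (simp add: root_poly_def degree_prod_eq_sum_degree)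

lemma lead_coeff_root_poly [simp]: "lead_coeff (root_poly Z) = 1"
  unfolding root_poly_def lead_coeff_prod by simp

lemma coeff_root_poly_card: "coeff (root_poly Z) (card Z) = 1"
  using lead_coeff_root_poly[of Z] by simp

lemma root_poly_neq_0 [simp]: "root_poly Z \<noteq> 0"
  using coeff_root_poly_card[of Z] by force

lemma poly_root_poly: "poly (root_poly Z) x = (\<Prod>r\<in>Z. x - r)"
  by (simp add: root_poly_def poly_prod)

lemma root_poly_dvd:
  assumes "finite Z" "\<And>r. r \<in> Z \<Longrightarrow> poly P r = 0"
  shows "root_poly Z dvd P"
  using assms
proof (induction Z arbitrary: P)
  case empty
  then show ?case by (simp add: root_poly_def)
next
  case (insert r Z)
  then obtain Q where Q: "P = [:- r, 1:] * Q"
    by (metis dvdE insertI1 poly_eq_0_iff_dvd)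
  have "poly Q s = 0" if "s \<in> Z" for s
    using insert.prems[of s] insert.hyps that by (auto simp: Q)
  then have "root_poly Z dvd Q" by (rule insert.IH)
  then show ?case using insert.hyps mult_dvd_mono[of "[:- r, 1:]" "[:- r, 1:]"]
    by (simp add: Q root_poly_def del: mult_pCons_left)
qed

text \<open>\<open>Z\<close> collects the zeros of odd multiplicity, so that \<open>R\<close> keeps its sign on the interval.\<close>

lemma sign_change_factorization:
  fixes P :: "real poly"
  shows "\<exists>Z R. finite Z \<and> Z \<subseteq> {a..b} \<and> P = root_poly Z * R \<and>
    ((\<forall>x\<in>{a..b}. poly R x \<ge> 0) \<or> (\<forall>x\<in>{a..b}. poly R x \<le> 0))"
proof (induction "degree P" arbitrary: P rule: less_induct)
  case less
  show ?case
  proof (cases "(\<forall>x\<in>{a..b}. poly P x \<ge> 0) \<or> (\<forall>x\<in>{a..b}. poly P x \<le> 0)")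
    case True
    then show ?thesis
      by (intro exI[of _ "{}"] exI[of _ P]) (auto simp: root_poly_def)
  next
    case False
    then obtain x y where xy: "x \<in> {a..b}" "y \<in> {a..b}" "poly P x < 0" "poly P y > 0"
      by (auto simp: not_le)
    then have "P \<noteq> 0" by auto
    have "\<exists>r\<in>{a..b}. poly P r = 0"
    proof (cases "x < y")
      case True
      then show ?thesis using poly_IVT_pos[of x y P] xy by auto
    next
      case False
      then have "y < x" using xy by (cases "x = y") auto
      then show ?thesis using poly_IVT_neg[of y x P] xy by auto
    qed
    then obtain r where r: "r \<in> {a..b}" "poly P r = 0" by blast
    then obtain Q where Q: "P = [:- r, 1:] * Q" by (metis dvdE poly_eq_0_iff_dvd)
    have "Q \<noteq> 0" using Q \<open>P \<noteq> 0\<close> by auto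
    then have "degree Q < degree P" unfolding Q by (subst degree_mult_eq) auto
    from less[OF this] obtain Z R where ZR: "finite Z" "Z \<subseteq> {a..b}" "Q = root_poly Z * R"
      "(\<forall>x\<in>{a..b}. poly R x \<ge> 0) \<or> (\<forall>x\<in>{a..b}. poly R x \<le> 0)" by blast
    show ?thesis
    proof (cases "r \<in> Z")
      case False
      then have "P = root_poly (insert r Z) * R"
        using ZR by (simp add: Q root_poly_def mult.assoc del: mult_pCons_left)
      then show ?thesis using ZR r by (intro exI[of _ "insert r Z"] exI[of _ R]) auto
    next
      \<comment> \<open>The two factors at \<open>r\<close> form a square, which moves into
        \<open>R\<close> without affecting its sign, and \<open>r\<close> leaves
        \<open>Z\<close>.\<close>
      case True
      then have "root_poly Z = [:- r, 1:] * root_poly (Z - {r})"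
        using ZR by (simp add: root_poly_def prod.remove del: mult_pCons_left)
      then have "P = root_poly (Z - {r}) * ([:- r, 1:]\<^sup>2 * R)"
        by (simp only: Q ZR(3) power2_eq_square mult_ac)
      moreover have "(\<forall>x\<in>{a..b}. poly ([:- r, 1:]\<^sup>2 * R) x \<ge> 0) \<or> (\<forall>x\<in>{a..b}. poly ([:- r, 1:]\<^sup>2 * R) x \<le> 0)"
        using ZR(4) unfolding poly_mult poly_power
        by (meson mult_nonneg_nonneg mult_nonneg_nonpos zero_le_power2)
      ultimately show ?thesis using ZR
        by (intro exI[of _ "Z - {r}"] exI[of _ "[:- r, 1:]\<^sup>2 * R"]) auto
    qed
  qed
qed

subsection \<open>Zeros, uniqueness, and the sign of the leading integrals\<close>

lemma poly_integral_monom: "poly_integral M (P * monom 1 l) = (LINT x|M. poly P x * x ^ l)"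
  by (simp add: poly_integral_def poly_monom)

lemma type_II_polyD:
  "type_II_poly \<mu> n P \<Longrightarrow> l < n j \<Longrightarrow> poly_integral (\<mu> j) (P * monom 1 l) = 0"
  by (simp add: type_II_poly_def poly_integral_monom)

text \<open>The additive form avoids truncated subtraction and serves both for raising and for
  lowering a component.\<close>

lemma msize_upd: "msize (n(j := k)) + n j = msize n + k"
proof -
  have "msize m = m j + (\<Sum>i\<in>UNIV - {j}. m i)" for m
    unfolding msize_def by (subst sum.remove[of _ j]) auto
  moreover have "(\<Sum>i\<in>UNIV - {j}. (n(j := k)) i) = (\<Sum>i\<in>UNIV - {j}. n i)"
    by (rule sum.cong) auto
  ultimately show ?thesis by simp
qed

context
  fixes \<mu> :: "'d::finite \<Rightarrow> real measure"
  assumes ang: "angelesco \<mu>"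
begin

lemma admissible: "admissible_measure (\<mu> j)"
  using ang by (simp add: angelesco_def)

lemma supp_hull_disjoint: "i \<noteq> j \<Longrightarrow> supp_hull (\<mu> i) \<inter> supp_hull (\<mu> j) = {}"
  using ang by (auto simp: angelesco_def)

lemma supp_hull_interval: "\<exists>a b. supp_hull (\<mu> j) = {a..b}"
  using ang by (auto simp: angelesco_def)

lemma supp_hull_nonempty: "supp_hull (\<mu> j) \<noteq> {}"
  using admissible[of j] by (auto simp: supp_hull_def admissible_measure_def)

lemma supp_hull_choice: "\<exists>c. \<forall>i. c i \<in> supp_hull (\<mu> i)"
  using supp_hull_nonempty by (intro choice) blast

text \<open>Disjoint intervals lie entirely on one side of each other. This replaces an ordering of
  the index type: one point chosen in each hull records all relative positions.\<close>

lemma sgn_diff_supp_hull: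
  assumes "i \<noteq> j" "x \<in> supp_hull (\<mu> i)" "x' \<in> supp_hull (\<mu> i)" "y \<in> supp_hull (\<mu> j)" "y' \<in> supp_hull (\<mu> j)"
  shows "sgn (x - y) = sgn (x' - y')"
proof -
  obtain a b c d where ab: "supp_hull (\<mu> i) = {a..b}" and cd: "supp_hull (\<mu> j) = {c..d}"
    using supp_hull_interval by meson
  have "b < c \<or> d < a"
  proof (rule ccontr)
    assume "\<not> ?thesis"
    then have "max a c \<in> {a..b} \<inter> {c..d}" using assms ab cd by auto
    then show False using supp_hull_disjoint[OF assms(1)] ab cd by auto
  qed
  then show ?thesis using assms ab cd by (auto simp: sgn_if)
qed

lemma type_II_poly_orthogonal:
  assumes P: "type_II_poly \<mu> n P" and q: "degree q < n j"
  shows "poly_integral (\<mu> j) (P * q) = 0"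
proof -
  have "P * q = (\<Sum>i\<le>degree q. smult (coeff q i) (P * monom 1 i))"
    by (subst poly_as_sum_of_monoms[of q, symmetric])
      (simp add: sum_distrib_left smult_monom flip: mult_smult_right)
  then show ?thesis
    using q type_II_polyD[OF P] by (simp add: poly_integral_sum[OF admissible])
qed

text \<open>With fewer than \<open>n j\<close> points in \<open>Z\<close>, orthogonality would apply
  to \<open>root_poly Z\<close>; yet \<open>P * root_poly Z\<close> is a square times
  \<open>R\<close>, hence of one sign on the hull, and has nonzero integral. Zeros in disjoint hulls
  are distinct, so they exhaust the degree.\<close>

lemma type_II_poly_zeros:
  assumes P: "type_II_poly \<mu> n P"
  obtains Z where "\<And>j. finite (Z j)" "\<And>j. Z j \<subseteq> supp_hull (\<mu> j)" "\<And>j. card (Z j) = n j"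
    "P = smult (lead_coeff P) (\<Prod>j\<in>UNIV. root_poly (Z j))" "degree P = msize n"
proof -
  have P0: "P \<noteq> 0" and deg: "degree P \<le> msize n"
    using P by (auto simp: type_II_poly_def)
  have "\<exists>Z. finite Z \<and> Z \<subseteq> supp_hull (\<mu> j) \<and> root_poly Z dvd P \<and> card Z \<ge> n j" for j
  proof -
    obtain a b where ab: "supp_hull (\<mu> j) = {a..b}" using supp_hull_interval by blast
    obtain Z R where ZR: "finite Z" "Z \<subseteq> {a..b}" "P = root_poly Z * R"
      "(\<forall>x\<in>{a..b}. poly R x \<ge> 0) \<or> (\<forall>x\<in>{a..b}. poly R x \<le> 0)"
      using sign_change_factorization[of a b P] by blast
    have "card Z \<ge> n j"
    proof (rule ccontr)
      assume "\<not> ?thesis"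
      then have "poly_integral (\<mu> j) (P * root_poly Z) = 0"
        by (intro type_II_poly_orthogonal[OF P]) simp
      moreover have eq: "P * root_poly Z = (root_poly Z)\<^sup>2 * R"
        by (simp add: ZR(3) power2_eq_square mult_ac)
      moreover have "R \<noteq> 0" using P0 ZR(3) by auto
      ultimately have zero: "poly_integral (\<mu> j) ((root_poly Z)\<^sup>2 * R) = 0" "(root_poly Z)\<^sup>2 * R \<noteq> 0"
        by auto
      from ZR(4) show False
      proof
        assume "\<forall>x\<in>{a..b}. poly R x \<ge> 0"
        then show False
          using poly_integral_pos[OF admissible zero(2), of j] zero(1) by (simp add: ab)
      next
        assume "\<forall>x\<in>{a..b}. poly R x \<le> 0"
        then have "poly (smult (- 1) ((root_poly Z)\<^sup>2 * R)) x \<ge> 0" if "x \<in> {a..b}" for x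
          using that by (simp add: mult_nonneg_nonpos)
        then have "poly_integral (\<mu> j) (smult (- 1) ((root_poly Z)\<^sup>2 * R)) > 0"
          using zero(2) by (intro poly_integral_pos[OF admissible]) (auto simp: ab)
        then show False using zero(1) by (simp only: poly_integral_smult)
      qed
    qed
    then show ?thesis using ZR ab by auto
  qed
  then obtain Z where Z: "\<And>j. finite (Z j)" "\<And>j. Z j \<subseteq> supp_hull (\<mu> j)"
    "\<And>j. root_poly (Z j) dvd P" "\<And>j. card (Z j) \<ge> n j" by metis
  have disj: "Z i \<inter> Z j = {}" if "i \<noteq> j" for i j
    using Z(2)[of i] Z(2)[of j] supp_hull_disjoint[OF that] by blast
  have root: "root_poly (\<Union>j. Z j) = (\<Prod>j\<in>UNIV. root_poly (Z j))"
    unfolding root_poly_def using Z(1) disj by (subst prod.UNION_disjoint) auto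
  have "root_poly (\<Union>j. Z j) dvd P"
  proof (rule root_poly_dvd)
    show "finite (\<Union>j. Z j)" using Z(1) by simp
    fix r assume "r \<in> (\<Union>j. Z j)"
    then obtain j where "r \<in> Z j" by blast
    then have "poly (root_poly (Z j)) r = 0" using Z(1) by (auto simp: poly_root_poly)
    then show "poly P r = 0" using Z(3)[of j] by auto
  qed
  then obtain C where C: "P = (\<Prod>j\<in>UNIV. root_poly (Z j)) * C" using root by (metis dvdE)
  have "C \<noteq> 0" using P0 C by auto
  have "(\<Prod>j\<in>UNIV. root_poly (Z j)) \<noteq> 0" by simp
  then have dP: "degree P = (\<Sum>j\<in>UNIV. card (Z j)) + degree C"
    unfolding C using \<open>C \<noteq> 0\<close> by (subst degree_mult_eq) (auto simp: degree_prod_eq_sum_degree)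
  have ge: "(\<Sum>j\<in>UNIV. card (Z j)) \<ge> msize n"
    unfolding msize_def by (rule sum_mono) (rule Z(4))
  \<comment> \<open>The degree bound on \<open>P\<close> meets the lower bound on the number of
    zeros: the cofactor is constant, and no hull can contain a surplus zero.\<close>
  then have dC: "degree C = 0" and size: "(\<Sum>j\<in>UNIV. card (Z j)) = msize n" using dP deg by linarith+
  have card: "card (Z j) = n j" for j
  proof (rule ccontr)
    assume "card (Z j) \<noteq> n j"
    then have "n j < card (Z j)" using Z(4)[of j] by simp
    then have "msize n < (\<Sum>j\<in>UNIV. card (Z j))"
      unfolding msize_def by (intro sum_strict_mono_ex1) (use Z(4) in auto)
    then show False using size by simp
  qed
  obtain c where c: "C = [:c:]" using dC by (metis degree_eq_zeroE)
  have P': "P = smult c (\<Prod>j\<in>UNIV. root_poly (Z j))" using C c by simp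
  then have "lead_coeff P = c * (\<Prod>j\<in>UNIV. lead_coeff (root_poly (Z j)))"
    by (simp add: lead_coeff_prod del: lead_coeff_root_poly)
  then have "lead_coeff P = c" by (simp del: degree_root_poly)
  then show thesis using P' dP dC size by (intro that[of Z] Z card) auto
qed

text \<open>This is the predicate under the definite description in \<open>mop\<close>, kept
  separate so that it can be established for a candidate polynomial first.\<close>

definition monic_type_II :: "('d \<Rightarrow> nat) \<Rightarrow> real poly \<Rightarrow> bool" where
  "monic_type_II n P \<longleftrightarrow> type_II_poly \<mu> n P \<and> degree P = msize n \<and> lead_coeff P = 1"

text \<open>The leading terms cancel in \<open>D\<close>. If \<open>D\<close> were nonzero, it would
  again be of type II for \<open>n\<close>, and \<open>type_II_poly_zeros\<close> would give it the
  full degree \<open>msize n\<close>.\<close>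

lemma type_II_poly_unique:
  assumes P: "monic_type_II n P" and Q: "type_II_poly \<mu> n Q"
  shows "Q = smult (lead_coeff Q) P"
proof (rule ccontr)
  assume neq: "\<not> ?thesis"
  define D where "D = Q - smult (lead_coeff Q) P"
  have P': "type_II_poly \<mu> n P" "degree P = msize n" "coeff P (msize n) = 1"
    using P by (auto simp: monic_type_II_def)
  have dQ: "degree Q = msize n" using type_II_poly_zeros[OF Q] by metis
  have D0: "D \<noteq> 0" using neq by (simp add: D_def)
  have dD: "degree D \<le> msize n" unfolding D_def using dQ P'(2)
    by (intro degree_diff_le) (auto intro: degree_smult_le[THEN order_trans])
  have "poly_integral (\<mu> j) (D * monom 1 l) = 0" if "l < n j" for j l
    using that type_II_polyD[OF P'(1), of l j] type_II_polyD[OF Q, of l j]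
    by (simp add: D_def left_diff_distrib poly_integral_diff[OF admissible])
  then have "type_II_poly \<mu> n D"
    using D0 dD by (simp add: type_II_poly_def poly_integral_monom)
  then have "degree D = msize n" using type_II_poly_zeros by metis
  moreover have "coeff D (msize n) = 0" using P'(3) dQ by (simp add: D_def)
  ultimately show False using D0 by (metis leading_coeff_0_iff)
qed

lemma mop_eqI:
  assumes "monic_type_II n P"
  shows "mop \<mu> n = P"
  unfolding mop_def
proof (rule the_equality)
  show "type_II_poly \<mu> n P \<and> degree P = msize n \<and> lead_coeff P = 1"
    using assms unfolding monic_type_II_def .
  fix Q assume "type_II_poly \<mu> n Q \<and> degree Q = msize n \<and> lead_coeff Q = 1"
  then show "Q = P" using type_II_poly_unique[OF assms, of Q] by (metis smult_1_left)
qed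

text \<open>The first moment against \<open>\<mu> j\<close> that orthogonality does not force to
  vanish, written \<open>h n j\<close> in the overview.\<close>

definition leading_integral :: "('d \<Rightarrow> nat) \<Rightarrow> 'd \<Rightarrow> real" where
  "leading_integral n j = poly_integral (\<mu> j) (mop \<mu> n * monom 1 (n j))"

text \<open>Replacing the monomial by \<open>root_poly (Z j)\<close> changes it only in lower
  degree, which orthogonality ignores. The integrand becomes a square times \<open>W\<close>, the
  factor from the other hulls, whose sign on hull \<open>j\<close> is constant. The product omits
  \<open>i = j\<close>, so \<open>n j\<close> does not affect the sign.\<close>

lemma sgn_leading_integral:
  assumes mon: "monic_type_II n (mop \<mu> n)" and c: "\<And>i. c i \<in> supp_hull (\<mu> i)"
  shows "sgn (leading_integral n j) = (\<Prod>i\<in>UNIV - {j}. sgn (c j - c i) ^ n i)"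
proof -
  let ?P = "mop \<mu> n"
  have P: "type_II_poly \<mu> n ?P" "lead_coeff ?P = 1" using mon by (auto simp: monic_type_II_def)
  obtain Z where Z: "\<And>j. finite (Z j)" "\<And>j. Z j \<subseteq> supp_hull (\<mu> j)" "\<And>j. card (Z j) = n j"
    "?P = (\<Prod>j\<in>UNIV. root_poly (Z j))"
    using type_II_poly_zeros[OF P(1)] P(2) by (metis smult_1_left)
  define W where "W = (\<Prod>i\<in>UNIV - {j}. root_poly (Z i))"
  define s where "s = (\<Prod>i\<in>UNIV - {j}. sgn (c j - c i) ^ n i)"
  have sW: "sgn (poly W x) = s" if "x \<in> supp_hull (\<mu> j)" for x
  proof -
    have "sgn (poly (root_poly (Z i)) x) = sgn (c j - c i) ^ n i" if "i \<in> UNIV - {j}" for i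
    proof -
      have "sgn (poly (root_poly (Z i)) x) = (\<Prod>r\<in>Z i. sgn (x - r))"
        by (simp add: poly_root_poly sgn_prod)
      also have "\<dots> = (\<Prod>r\<in>Z i. sgn (c j - c i))"
        by (rule prod.cong) (use that \<open>x \<in> _\<close> Z(2) c in \<open>auto intro!: sgn_diff_supp_hull[of j i]\<close>)
      finally show ?thesis by (simp add: Z(3))
    qed
    then show ?thesis by (simp add: W_def poly_prod sgn_prod s_def)
  qed
  have s: "s = 1 \<or> s = - 1"
  proof -
    have "c j \<noteq> c i" if "i \<noteq> j" for i using supp_hull_disjoint[OF that] c[of i] c[of j] by auto
    then have "s \<noteq> 0" by (auto simp: s_def sgn_0_0)
    then show ?thesis using sW[OF c[of j]] by (auto simp: sgn_if split: if_splits)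
  qed
  have PW: "?P * root_poly (Z j) = (root_poly (Z j))\<^sup>2 * W"
    unfolding Z(4) W_def by (subst prod.remove[of _ j]) (auto simp: power2_eq_square mult_ac)
  have W0: "W \<noteq> 0" by (simp add: W_def)
  have "0 \<le> s * poly W x" if "x \<in> supp_hull (\<mu> j)" for x
    using sW[OF that] by (metis abs_ge_zero abs_sgn mult.commute)
  then have "poly_integral (\<mu> j) (smult s ((root_poly (Z j))\<^sup>2 * W)) > 0"
    using s W0 by (intro poly_integral_pos[OF admissible]) (auto simp: mult.left_commute mult_nonneg_nonpos)
  then have pos: "s * poly_integral (\<mu> j) (?P * root_poly (Z j)) > 0" by (simp add: PW)
  define q where "q = root_poly (Z j) - monom 1 (n j)"
  have "poly_integral (\<mu> j) (?P * q) = 0"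
  proof (cases "q = 0")
    case False
    have "degree q \<le> n j" unfolding q_def
      by (intro degree_diff_le) (auto simp: Z(3) degree_monom_le)
    moreover have "coeff q (n j) = 0"
      using coeff_root_poly_card[of "Z j"] by (simp add: q_def Z(3))
    ultimately have "degree q < n j" using False by (metis le_neq_implies_less leading_coeff_0_iff)
    then show ?thesis by (rule type_II_poly_orthogonal[OF P(1)])
  qed simp
  moreover have "?P * root_poly (Z j) = ?P * monom 1 (n j) + ?P * q"
    by (simp add: q_def algebra_simps)
  ultimately have "s * leading_integral n j > 0"
    using pos by (simp add: leading_integral_def poly_integral_add[OF admissible])
  then show ?thesis using s unfolding s_def[symmetric] by (auto simp: sgn_if)
qed

lemma leading_integral_neq_0:
  assumes "monic_type_II n (mop \<mu> n)"
  shows "leading_integral n j \<noteq> 0"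
proof -
  obtain c where c: "\<And>i. c i \<in> supp_hull (\<mu> i)" using supp_hull_choice by blast
  have "c j \<noteq> c i" if "i \<noteq> j" for i using supp_hull_disjoint[OF that] c[of i] c[of j] by auto
  then have "(\<Prod>i\<in>UNIV - {j}. sgn (c j - c i) ^ n i) \<noteq> 0" by (auto simp: sgn_0_0)
  then show ?thesis using sgn_leading_integral[OF assms c, of j] by (metis sgn_0)
qed

subsection \<open>The recurrence\<close>

definition coeff_a :: "('d \<Rightarrow> nat) \<Rightarrow> 'd \<Rightarrow> real" where
  "coeff_a n l = (if n l = 0 then 0 else leading_integral n l / leading_integral (n(l := n l - 1)) l)"

text \<open>Solves the one orthogonality condition that is new at the raised index:
  \<open>mop_next n j\<close> against \<open>monom 1 (n j)\<close> under
  \<open>\<mu> j\<close>.\<close>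

definition coeff_b :: "('d \<Rightarrow> nat) \<Rightarrow> 'd \<Rightarrow> real" where
  "coeff_b n j = (poly_integral (\<mu> j) ([:0, 1:] * mop \<mu> n * monom 1 (n j)) -
     (\<Sum>l\<in>UNIV. coeff_a n l * poly_integral (\<mu> j) (mop_prev \<mu> n l * monom 1 (n j))))
     / leading_integral n j"

text \<open>The recurrence solved for its next polynomial. It refers to \<open>mop\<close> only at
  \<open>n\<close> and its predecessors, so it is available before existence at the raised index is
  known.\<close>

definition mop_next :: "('d \<Rightarrow> nat) \<Rightarrow> 'd \<Rightarrow> real poly" where
  "mop_next n j = [:0, 1:] * mop \<mu> n - smult (coeff_b n j) (mop \<mu> n)
     - (\<Sum>l\<in>UNIV. smult (coeff_a n l) (mop_prev \<mu> n l))"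

text \<open>Below degree \<open>n i\<close>, lowering component \<open>k\<close> loses a condition
  under \<open>\<mu> i\<close> only if \<open>k = i\<close>, and then just the top one. The
  hypothesis is limited to sizes up to \<open>msize n\<close> for use inside the existence
  induction.\<close>

lemma poly_integral_mop_prev:
  assumes mon: "\<And>m. msize m \<le> msize n \<Longrightarrow> monic_type_II m (mop \<mu> m)" and l: "l < n i"
  shows "poly_integral (\<mu> i) (mop_prev \<mu> n k * monom 1 l) =
    (if k = i \<and> l + 1 = n i then leading_integral (n(i := n i - 1)) i else 0)"
proof (cases "n k = 0")
  case True
  then show ?thesis using l by (auto simp: mop_prev_def)
next
  case False
  have "msize (n(k := n k - 1)) \<le> msize n" using msize_upd[of n k "n k - 1"] False by linarith
  then have "type_II_poly \<mu> (n(k := n k - 1)) (mop \<mu> (n(k := n k - 1)))"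
    using mon by (auto simp: monic_type_II_def)
  then have zero: "poly_integral (\<mu> i) (mop_prev \<mu> n k * monom 1 l) = 0"
    if "l < (n(k := n k - 1)) i"
    using type_II_polyD that False by (metis mop_prev_def)
  show ?thesis
  proof (cases "k = i \<and> l + 1 = n i")
    case True
    then have "n i - Suc 0 = l" by linarith
    with True False show ?thesis by (simp add: mop_prev_def leading_integral_def)
  next
    case False
    then show ?thesis using l by (subst zero) auto
  qed
qed

text \<open>The inductive step for existence. All subtracted terms have degree at most
  \<open>msize n\<close>, so the leading term of \<open>x\<close> times \<open>mop \<mu> n\<close>
  survives.\<close>

lemma monic_type_II_mop_next:
  assumes mon: "\<And>m. msize m \<le> msize n \<Longrightarrow> monic_type_II m (mop \<mu> m)"
  shows "monic_type_II (n(j := n j + 1)) (mop_next n j)"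
proof -
  let ?P = "mop \<mu> n" and ?N = "msize n"
  have P: "type_II_poly \<mu> n ?P" "degree ?P = ?N" "lead_coeff ?P = 1"
    using mon[of n] by (auto simp: monic_type_II_def)
  have dprev: "degree (mop_prev \<mu> n l) \<le> ?N" for l
  proof (cases "n l = 0")
    case False
    then have "msize (n(l := n l - 1)) \<le> ?N" using msize_upd[of n l "n l - 1"] by linarith
    then show ?thesis using mon[of "n(l := n l - 1)"] by (simp add: mop_prev_def monic_type_II_def)
  qed (simp add: mop_prev_def)
  define T where "T = smult (coeff_b n j) ?P + (\<Sum>l\<in>UNIV. smult (coeff_a n l) (mop_prev \<mu> n l))"
  have dT: "degree T \<le> ?N" unfolding T_def using P dprev
    by (intro degree_add_le degree_sum_le) (auto intro: degree_smult_le[THEN order_trans])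
  have R: "mop_next n j = pCons 0 ?P - T" by (simp add: mop_next_def T_def)
  have P0: "?P \<noteq> 0" using P(3) by auto
  have c1: "coeff (mop_next n j) (Suc ?N) = 1"
    using dT P by (simp add: R coeff_eq_0)
  have size: "msize (n(j := n j + 1)) = Suc ?N" using msize_upd[of n j "n j + 1"] by simp
  have "degree (mop_next n j) \<le> Suc ?N" unfolding R
    using dT P(2) P0 by (intro degree_diff_le) auto
  then have dR: "degree (mop_next n j) = Suc ?N"
    using c1 by (intro antisym le_degree) auto
  have "poly_integral (\<mu> i) (mop_next n j * monom 1 l) = 0" if l: "l < (n(j := n j + 1)) i" for i l
  proof -
    have shift: "[:0, 1:] * ?P * monom 1 l = ?P * monom 1 (Suc l)"
      by (simp add: monom_Suc)
    have expand: "poly_integral (\<mu> i) (mop_next n j * monom 1 l) =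
      poly_integral (\<mu> i) ([:0, 1:] * ?P * monom 1 l)
      - coeff_b n j * poly_integral (\<mu> i) (?P * monom 1 l)
      - (\<Sum>k\<in>UNIV. coeff_a n k * poly_integral (\<mu> i) (mop_prev \<mu> n k * monom 1 l))"
      unfolding mop_next_def left_diff_distrib sum_distrib_right
      by (simp only: poly_integral_diff[OF admissible] poly_integral_sum[OF admissible]
          mult_smult_left poly_integral_smult)
    \<comment> \<open>In the first case every term vanishes. In the second the summand
      \<open>k = i\<close> cancels \<open>leading_integral n i\<close> by the choice of
      \<open>coeff_a\<close>. The third is the new condition, met by the choice of
      \<open>coeff_b\<close>.\<close>
    consider "l + 1 < n i" | "l + 1 = n i" | "i = j" "l = n j" using l by (fastforce split: if_splits)
    then show ?thesis
    proof cases
      case 1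
      then show ?thesis unfolding expand shift
        using type_II_polyD[OF P(1), of l i] type_II_polyD[OF P(1), of "Suc l" i]
        by (simp add: poly_integral_mop_prev[OF mon])
    next
      case 2
      have "leading_integral (n(i := n i - 1)) i \<noteq> 0"
        using msize_upd[of n i "n i - 1"] 2 by (intro leading_integral_neq_0 mon) linarith
      moreover have "(\<Sum>k\<in>UNIV. coeff_a n k * poly_integral (\<mu> i) (mop_prev \<mu> n k * monom 1 l))
        = (\<Sum>k\<in>UNIV. if k = i then coeff_a n i * leading_integral (n(i := n i - 1)) i else 0)"
        using 2 by (intro sum.cong) (auto simp: poly_integral_mop_prev[OF mon])
      moreover have "poly_integral (\<mu> i) (?P * monom 1 (Suc l)) = leading_integral n i"
        using 2 by (simp add: leading_integral_def)
      ultimately show ?thesis unfolding expand shift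
        using type_II_polyD[OF P(1), of l i] 2 by (simp add: coeff_a_def)
    next
      case 3
      have "leading_integral n j \<noteq> 0" using leading_integral_neq_0 mon[of n] by simp
      then show ?thesis unfolding expand unfolding 3 leading_integral_def[symmetric]
        by (simp add: coeff_b_def del: mult_pCons_left)
    qed
  qed
  then show ?thesis using dR c1 size
    by (auto simp: monic_type_II_def type_II_poly_def poly_integral_monom)
qed

text \<open>Induction on the size: the constant 1 serves the zero index, and any other index is some
  \<open>m\<close> raised in a direction \<open>j\<close>, where \<open>mop_next m j\<close> serves.
  \<open>mop_eqI\<close> carries the result over to \<open>mop\<close>.\<close>

lemma monic_type_II_mop: "monic_type_II n (mop \<mu> n)"
proof (induction "msize n" arbitrary: n rule: less_induct)
  case less
  show ?case
  proof (cases "msize n = 0")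
    case True
    then have "monic_type_II n 1"
      by (simp add: monic_type_II_def type_II_poly_def msize_def)
    then show ?thesis using mop_eqI by metis
  next
    case False
    then obtain j where j: "n j > 0" by (auto simp: msize_def)
    define m where "m = n(j := n j - 1)"
    have n: "n = m(j := m j + 1)" using j by (auto simp: m_def fun_eq_iff)
    have "msize m < msize n" using msize_upd[of n j "n j - 1"] j unfolding m_def by linarith
    then have "monic_type_II n (mop_next m j)"
      unfolding n by (intro monic_type_II_mop_next less) (simp add: n)
    then show ?thesis using mop_eqI by metis
  qed
qed

lemma perfect: "perfect_system \<mu>"
  unfolding perfect_system_def normal_index_def
proof (intro allI exI conjI impI)
  fix n Q
  show "type_II_poly \<mu> n (mop \<mu> n)"
    using monic_type_II_mop[of n] by (simp add: monic_type_II_def)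
  assume "type_II_poly \<mu> n Q"
  then show "Q = smult (lead_coeff Q) (mop \<mu> n)"
    by (rule type_II_poly_unique[OF monic_type_II_mop])
qed

lemma mop_type_II: "type_II_poly \<mu> n (mop \<mu> n)"
  using monic_type_II_mop[of n] by (simp add: monic_type_II_def)

text \<open>Uniqueness identifies the candidate with the actual polynomial, so the recurrence is a
  rearrangement of the definition of \<open>mop_next\<close>.\<close>

lemma mop_upd: "mop \<mu> (n(j := n j + 1)) = mop_next n j"
  by (intro mop_eqI monic_type_II_mop_next monic_type_II_mop)

lemma recurrence: "nn_recurrence \<mu> coeff_a coeff_b"
  unfolding nn_recurrence_def mop_upd by (simp add: mop_next_def coeff_a_def)

text \<open>Testing the recurrence in direction \<open>i\<close> against degree
  \<open>n i - 1\<close> under \<open>\<mu> i\<close> leaves only the term with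
  \<open>a n i\<close>; for \<open>n i = 0\<close> the zero convention decides. Once
  \<open>a\<close> is known, comparing two recurrences leaves multiples of the nonzero
  \<open>mop \<mu> n\<close>, which fixes \<open>b\<close>.\<close>

lemma recurrence_unique:
  assumes "nn_recurrence \<mu> a b"
  shows "a = coeff_a" "b = coeff_b"
proof -
  have rec: "[:0, 1:] * mop \<mu> n = mop \<mu> (n(j := n j + 1)) + smult (b n j) (mop \<mu> n)
        + (\<Sum>l\<in>UNIV. smult (a n l) (mop_prev \<mu> n l))" for n j
    using assms unfolding nn_recurrence_def by blast
  have zero: "a n l = 0" if "n l = 0" for n l
    using assms that unfolding nn_recurrence_def by blast
  show a: "a = coeff_a"
  proof (intro ext)
    fix n i
    show "a n i = coeff_a n i"
    proof (cases "n i = 0")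
      case True
      then show ?thesis by (simp add: zero coeff_a_def)
    next
      case False
      then obtain l where l: "n i = Suc l" by (cases "n i") auto
      have "leading_integral n i = poly_integral (\<mu> i) ([:0, 1:] * mop \<mu> n * monom 1 l)"
        by (simp add: leading_integral_def l monom_Suc)
      also have "\<dots> = poly_integral (\<mu> i) (mop \<mu> (n(i := n i + 1)) * monom 1 l)
          + b n i * poly_integral (\<mu> i) (mop \<mu> n * monom 1 l)
          + (\<Sum>k\<in>UNIV. a n k * poly_integral (\<mu> i) (mop_prev \<mu> n k * monom 1 l))"
        unfolding rec[of n i] distrib_right sum_distrib_right
        by (simp only: poly_integral_add[OF admissible] poly_integral_sum[OF admissible]
          mult_smult_left poly_integral_smult)
      also have "poly_integral (\<mu> i) (mop \<mu> (n(i := n i + 1)) * monom 1 l) = 0"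
        using l by (intro type_II_polyD[OF mop_type_II]) simp
      also have "poly_integral (\<mu> i) (mop \<mu> n * monom 1 l) = 0"
        using l by (intro type_II_polyD[OF mop_type_II]) simp
      also have "(\<Sum>k\<in>UNIV. a n k * poly_integral (\<mu> i) (mop_prev \<mu> n k * monom 1 l))
        = (\<Sum>k\<in>UNIV. if k = i then a n i * leading_integral (n(i := n i - 1)) i else 0)"
        using l by (intro sum.cong) (auto simp: poly_integral_mop_prev[OF monic_type_II_mop])
      finally have "leading_integral n i = a n i * leading_integral (n(i := n i - 1)) i" by simp
      then show ?thesis using False leading_integral_neq_0[OF monic_type_II_mop]
        by (simp add: coeff_a_def)
    qed
  qed
  show "b = coeff_b"
  proof (intro ext)
    fix n j
    have "mop \<mu> n \<noteq> 0" using mop_type_II by (simp add: type_II_poly_def)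
    moreover have "smult (b n j) (mop \<mu> n) = smult (coeff_b n j) (mop \<mu> n)"
    proof -
      have "[:0, 1:] * mop \<mu> n = mop \<mu> (n(j := n j + 1)) + smult (coeff_b n j) (mop \<mu> n)
        + (\<Sum>l\<in>UNIV. smult (coeff_a n l) (mop_prev \<mu> n l))"
        using recurrence unfolding nn_recurrence_def by blast
      then show ?thesis unfolding rec[of n j] a by (simp only: add_left_cancel add_right_cancel)
    qed
    ultimately have "smult (b n j - coeff_b n j) (mop \<mu> n) = 0" "mop \<mu> n \<noteq> 0"
      by (simp_all add: smult_diff_left)
    then show "b n j = coeff_b n j" by simp
  qed
qed

lemma nn_coeffs_eq: "nn_coeffs \<mu> = (coeff_a, coeff_b)"
  unfolding nn_coeffs_def
proof (rule the_equality)
  fix p assume "case p of (a, b) \<Rightarrow> nn_recurrence \<mu> a b"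
  then show "p = (coeff_a, coeff_b)"
    using recurrence_unique[of "fst p" "snd p"] by (simp add: case_prod_beta prod_eq_iff)
qed (simp add: recurrence)

text \<open>Lowering component \<open>j\<close> leaves the sign formula for direction
  \<open>j\<close> unchanged, so \<open>coeff_a n j\<close> is a quotient of nonzero numbers of
  equal sign.\<close>

lemma coeff_a_pos:
  assumes "n j > 0"
  shows "coeff_a n j > 0"
proof -
  obtain c where c: "\<And>i. c i \<in> supp_hull (\<mu> i)" using supp_hull_choice by blast
  let ?m = "n(j := n j - 1)"
  note sgn = sgn_leading_integral[OF monic_type_II_mop c]
  have "sgn (leading_integral n j) = sgn (leading_integral ?m j)"
    unfolding sgn by (rule prod.cong) auto
  then show ?thesis using assms leading_integral_neq_0[OF monic_type_II_mop, of ?m j]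
    by (auto simp: coeff_a_def sgn_if zero_less_divide_iff split: if_splits)
qed

lemma coeff_a_nonneg: "coeff_a n j \<ge> 0"
  using coeff_a_pos[of n j] by (cases "n j = 0") (auto simp: coeff_a_def)

subsection \<open>Boundedness\<close>

text \<open>All zeros lie strictly between \<open>- B\<close> and \<open>B\<close>, so each of the
  \<open>msize n\<close> linear factors is positive at \<open>B\<close> and negative at
  \<open>- B\<close>.\<close>

lemma mop_sign_outside:
  assumes B: "\<forall>j. \<forall>x\<in>supp_hull (\<mu> j). \<bar>x\<bar> < B"
  shows "poly (mop \<mu> n) B > 0" "(- 1) ^ msize n * poly (mop \<mu> n) (- B) > 0"
proof -
  have "lead_coeff (mop \<mu> n) = 1" using monic_type_II_mop[of n] by (metis monic_type_II_def)
  with type_II_poly_zeros[OF mop_type_II[of n]]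
  obtain Z where Z: "\<And>j. Z j \<subseteq> supp_hull (\<mu> j)" "\<And>j. card (Z j) = n j"
    "mop \<mu> n = (\<Prod>j\<in>UNIV. root_poly (Z j))" by (metis smult_1_left)
  have less: "\<bar>r\<bar> < B" if "r \<in> Z j" for r j using B Z(1) that by blast
  show "poly (mop \<mu> n) B > 0"
    unfolding Z(3) poly_prod poly_root_poly by (intro prod_pos) (use less in force)
  have "(- 1) ^ msize n = (\<Prod>j\<in>UNIV. \<Prod>r\<in>Z j. - 1 :: real)"
    by (simp add: msize_def Z(2) power_sum)
  then have "(- 1) ^ msize n * poly (mop \<mu> n) (- B) = (\<Prod>j\<in>UNIV. \<Prod>r\<in>Z j. B + r)"
    unfolding Z(3) poly_prod poly_root_poly by (simp only: prod.distrib[symmetric]) (simp add: add.commute)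
  also have "\<dots> > 0" by (intro prod_pos) (use less in force)
  finally show "(- 1) ^ msize n * poly (mop \<mu> n) (- B) > 0" .
qed

lemma recurrence_eval:
  "(x - coeff_b n j) * poly (mop \<mu> n) x = poly (mop \<mu> (n(j := n j + 1))) x
    + (\<Sum>l\<in>UNIV. coeff_a n l * poly (mop_prev \<mu> n l) x)"
  unfolding mop_upd by (simp add: mop_next_def poly_sum algebra_simps)

lemma coeff_bounds:
  assumes B: "\<forall>j. \<forall>x\<in>supp_hull (\<mu> j). \<bar>x\<bar> < B"
  shows "\<bar>coeff_b n j\<bar> < B" "coeff_a n j \<le> (2 * B)\<^sup>2"
proof -
  let ?v = "\<lambda>n. poly (mop \<mu> n) B" and ?u = "\<lambda>n. (- 1) ^ msize n * poly (mop \<mu> n) (- B)"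
  note pos = mop_sign_outside[OF B]
  have prev: "0 \<le> coeff_a n l * poly (mop_prev \<mu> n l) B" for n l
    using coeff_a_nonneg[of n l] pos(1) by (simp add: mop_prev_def less_imp_le)
  \<comment> \<open>At \<open>B\<close> the right-hand side of \<open>recurrence_eval\<close> is a
    positive value plus nonnegative ones; dropping the latter gives \<open>step\<close>.\<close>
  have b_less: "coeff_b n j < B" and step: "?v (n(j := n j + 1)) \<le> (B - coeff_b n j) * ?v n" for n j
  proof -
    show "?v (n(j := n j + 1)) \<le> (B - coeff_b n j) * ?v n"
      unfolding recurrence_eval using prev by (simp add: sum_nonneg)
    then have "0 < (B - coeff_b n j) * ?v n" using pos(1)[of "n(j := n j + 1)"] by linarith
    then show "coeff_b n j < B" using pos(1)[of n] by (simp add: zero_less_mult_iff)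
  qed
  \<comment> \<open>The next and previous indices have sizes of parity opposite to
    \<open>msize n\<close>. After multiplication by \<open>(- 1) ^ msize n\<close>, the right-hand
    side at \<open>- B\<close> is therefore negative.\<close>
  have b_gt: "- B < coeff_b n j" for n j
  proof -
    have "(- 1) ^ msize n * (coeff_a n l * poly (mop_prev \<mu> n l) (- B)) \<le> 0" for l
    proof (cases "n l = 0")
      case False
      let ?m = "n(l := n l - 1)"
      have "msize n = Suc (msize ?m)" using msize_upd[of n l "n l - 1"] False by linarith
      then have "(- 1) ^ msize n * (coeff_a n l * poly (mop_prev \<mu> n l) (- B)) = - (coeff_a n l * ?u ?m)"
        using False by (simp add: mop_prev_def)
      then show ?thesis using coeff_a_nonneg[of n l] pos(2)[of ?m] by simp
    qed (simp add: mop_prev_def)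
    then have sum: "(\<Sum>l\<in>UNIV. (- 1) ^ msize n * (coeff_a n l * poly (mop_prev \<mu> n l) (- B))) \<le> 0"
      by (rule sum_nonpos)
    have "msize (n(j := n j + 1)) = Suc (msize n)" using msize_upd[of n j "n j + 1"] by simp
    then have shift: "(- 1) ^ msize n * poly (mop \<mu> (n(j := n j + 1))) (- B) = - ?u (n(j := n j + 1))"
      by simp
    have "(- B - coeff_b n j) * ?u n = (- 1) ^ msize n * ((- B - coeff_b n j) * poly (mop \<mu> n) (- B))"
      by (rule mult.left_commute)
    also have "\<dots> = - ?u (n(j := n j + 1))
        + (\<Sum>l\<in>UNIV. (- 1) ^ msize n * (coeff_a n l * poly (mop_prev \<mu> n l) (- B)))"
      unfolding recurrence_eval distrib_left sum_distrib_left shift ..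
    finally have "(- B - coeff_b n j) * ?u n < 0" using sum pos(2)[of "n(j := n j + 1)"] by linarith
    then show ?thesis
      using mult_nonneg_nonneg[of "- B - coeff_b n j" "?u n"] pos(2)[of n] by linarith
  qed
  show "\<bar>coeff_b n j\<bar> < B" using b_less[of n j] b_gt[of n j] by linarith
  show "coeff_a n j \<le> (2 * B)\<^sup>2"
  proof (cases "n j = 0")
    case False
    let ?m = "n(j := n j - 1)"
    have n: "?m(j := ?m j + 1) = n" using False by (auto simp: fun_eq_iff)
    \<comment> \<open>Only the summand \<open>l = j\<close> is kept. The two factors
      \<open>2 * B\<close> bound \<open>B - coeff_b\<close> at \<open>n\<close> and at
      \<open>?m\<close>; the second arises from \<open>step\<close>, which returns from
      \<open>n\<close> to \<open>?m\<close> so that the positive \<open>?v ?m\<close>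
      cancels.\<close>
    have "coeff_a n j * ?v ?m \<le> (\<Sum>l\<in>UNIV. coeff_a n l * poly (mop_prev \<mu> n l) B)"
      using member_le_sum[of j UNIV "\<lambda>l. coeff_a n l * poly (mop_prev \<mu> n l) B"] prev False
      by (simp add: mop_prev_def)
    also have "\<dots> \<le> (B - coeff_b n j) * ?v n"
      unfolding recurrence_eval using pos(1)[of "n(j := n j + 1)"] by simp
    also have "\<dots> \<le> (2 * B) * ?v n"
      using b_gt[of n j] pos(1)[of n] by (intro mult_right_mono) auto
    also have "\<dots> \<le> (2 * B) * ((2 * B) * ?v ?m)"
    proof (intro mult_left_mono)
      have "?v n \<le> (B - coeff_b ?m j) * ?v ?m" using step[of ?m j] unfolding n .
      also have "\<dots> \<le> (2 * B) * ?v ?m"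
        using b_gt[of ?m j] pos(1)[of ?m] by (intro mult_right_mono) auto
      finally show "?v n \<le> (2 * B) * ?v ?m" .
      show "0 \<le> 2 * B" using b_gt[of n j] b_less[of n j] by linarith
    qed
    finally have "coeff_a n j * ?v ?m \<le> (2 * B)\<^sup>2 * ?v ?m" by (simp add: power2_eq_square)
    then show ?thesis using pos(1)[of ?m] by (rule mult_right_le_imp_le)
  qed (simp add: coeff_a_def)
qed

text \<open>The strict inequality keeps both evaluation points \<open>B\<close> and
  \<open>- B\<close> off every hull.\<close>

lemma supp_hulls_bounded: "\<exists>B. \<forall>j. \<forall>x\<in>supp_hull (\<mu> j). \<bar>x\<bar> < B"
proof -
  have "bounded (supp_hull (\<mu> j))" for j
    using supp_hull_interval[of j] bounded_closed_interval by metis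
  then have "bounded (\<Union>j. supp_hull (\<mu> j))" by (intro bounded_UN) auto
  then show ?thesis by (fastforce simp: bounded_pos_less)
qed

end

theorem theorem4p1:
  fixes \<mu> :: "'d::finite \<Rightarrow> real measure"
  assumes "angelesco \<mu>"
  shows "perfect_system \<mu> \<and>
    (\<forall>n j. n j > 0 \<longrightarrow> nn_a \<mu> n j > 0) \<and>
    (SUP (n, j) \<in> {n. \<forall>i. n i \<ge> 1} \<times> UNIV. ereal (nn_a \<mu> n j)) < \<infinity> \<and>
    (SUP (n, j) \<in> {n. \<forall>i. n i \<ge> 1} \<times> UNIV. ereal \<bar>nn_b \<mu> n j\<bar>) < \<infinity>"
proof -
  have a: "nn_a \<mu> = coeff_a \<mu>" and b: "nn_b \<mu> = coeff_b \<mu>"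
    by (simp_all add: nn_a_def nn_b_def nn_coeffs_eq[OF assms])
  obtain B where B: "\<forall>j. \<forall>x\<in>supp_hull (\<mu> j). \<bar>x\<bar> < B"
    using supp_hulls_bounded[OF assms] by blast
  note bounds = coeff_bounds[OF assms B]
  have "(SUP (n, j) \<in> {n. \<forall>i. n i \<ge> 1} \<times> UNIV. ereal (nn_a \<mu> n j)) \<le> ereal ((2 * B)\<^sup>2)"
    unfolding a using bounds(2) by (intro SUP_least) auto
  moreover have "(SUP (n, j) \<in> {n. \<forall>i. n i \<ge> 1} \<times> UNIV. ereal \<bar>nn_b \<mu> n j\<bar>) \<le> ereal B"
    unfolding b using bounds(1) by (intro SUP_least) (auto intro: less_imp_le)
  ultimately show ?thesis
    using perfect[OF assms] coeff_a_pos[OF assms]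
    unfolding a by (auto intro: le_less_trans)
qed

end
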